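(* Let $X$ be a Banach space over $\mathbb{R}$ or $\mathbb{C}$, and let $X_1\subset X_2\subset\cdots\subset X$ be closed (not necessarily finite-dimensional) subspaces with $X=\overline{\bigcup_{m=1}^{\infty}X_m}$. Suppose that for every $m\in\mathbb{N}$ there is a continuous linear projection $P_m$ from $X$ onto $X_m$ with $\|P_m\|=1$, and that these projections satisfy $P_m(P_jx)=P_mx$ for all $x\in X$ and all $j\ge m$. Assume that the norm of $X$ satisfies the Characterization Condition (CC) with respect to $(X_m)$ and $(P_m)$. Then: (1) for every $m\in\mathbb{N}$ and every $L\in\mathcal{L}(X_m)$, $n_1(L)=\nu(L)$; (2) for every $L\in\mathcal{L}(X)$, $n_1(L)=\nu(L)$; (3) $n(X)=\lim_{m\to\infty} n(X_m)$.
   Context: For a Banach space $Z$, $S_Z$ denotes its unit sphere, $Z^*$ its dual, and $\mathcal{L}(Z)$ the space of bounded linear operators on $Z$ with the operator norm. Numerical radius and index. For $T\in\mathcal{L}(Z)$, $\nu(T)=\sup\{|x^*(Tx)| : x\in S_Z,\ x^*\in S_{Z^*},\ x^*(x)=1\}$, and $n(Z)=\inf\{\nu(T): T\in\mathcal{L}(Z),\ \|T\|=1\}$. For $L\in\mathcal{L}(X_m)$, $\nu(L)$ is computed in the space $Z=X_m$. The quantity $n_1$. For $L\in\mathcal{L}(X_m)$, $$n_1(L)=\sup\{|x^*(P_jLP_jx)| : j\in\{1,\ldots,m\},\ x^*\in S_{X^*},\ x\in S_X,\ x^*(x)=1\};$$ for $L\in\mathcal{L}(X)$, $$n_1(L)=\sup\{|x^*(P_jLP_jx)|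 : j\in\mathbb{N},\ x^*\in S_{X^*},\ x\in S_X,\ x^*(x)=1\}.$$ Norming functional. A norming functional for a nonzero $z\in Z$ is an $f\in Z^*$ with $\|f\|=1$ and $f(z)=\|z\|$. Characterization Condition (CC). For every $x\in X$ with $\|x\|=1$, every norming functional $x^*\in X^*$ for $x$, and every $m\in\mathbb{N}$ with $P_mx\ne 0$, there exists a constant (scalar) $b_m(x)$ such that $b_m(x)\,x^*|_{X_m}$ is a norming functional for $P_mx$ in $X_m^*$. *)

theory Defs
  imports "HOL-Analysis.Analysis"
begin

(* The scalar fields: up to an isometric isomorphism of fields, exactly the real and the
   complex numbers. *)
class real_or_complex = real_normed_field +
  assumes real_or_complex:
    "(\<exists>\<phi> :: 'a \<Rightarrow> real. bij \<phi> \<and> (\<forall>x y. \<phi> (x + y) = \<phi> x + \<phi> y) \<and>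
        (\<forall>x y. \<phi> (x * y) = \<phi> x * \<phi> y) \<and> (\<forall>x. norm (\<phi> x) = norm x)) \<or>
     (\<exists>\<phi> :: 'a \<Rightarrow> complex. bij \<phi> \<and> (\<forall>x y. \<phi> (x + y) = \<phi> x + \<phi> y) \<and>
        (\<forall>x y. \<phi> (x * y) = \<phi> x * \<phi> y) \<and> (\<forall>x. norm (\<phi> x) = norm x))"

instance real :: real_or_complex
  by standard (rule disjI1, rule exI[of _ id], simp)

instance complex :: real_or_complex
  by standard (rule disjI2, rule exI[of _ id], simp)

(* Completeness is part of the class banach. *)
locale banach_space_over = vector_space smul
  for smul :: "'k::real_or_complex \<Rightarrow> 'a::banach \<Rightarrow> 'a" +
  assumes norm_scale: "norm (smul c x) = norm c * norm x"
    and scale_of_real: "smul (of_real r) x = r *\<^sub>R x"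

lemma banach_space_over_real:
  "banach_space_over (scaleR :: real \<Rightarrow> 'a::banach \<Rightarrow> 'a)"
  by standard (auto simp: algebra_simps)

lemma banach_space_over_complex:
  "banach_space_over ((*) :: complex \<Rightarrow> complex \<Rightarrow> complex)"
  by standard (auto simp: algebra_simps norm_mult scaleR_conv_of_real)

(* Below, Z is a linear subspace of the ambient type (UNIV for the whole space), regarded as a
   normed space in its own right. Operators and functionals on Z are functions on the ambient
   type of which only the values on Z are ever used. *)

definition bounded_linear_on ::
  "('k::real_normed_field \<Rightarrow> 'a::real_normed_vector \<Rightarrow> 'a) \<Rightarrow>
   ('k \<Rightarrow> 'b::real_normed_vector \<Rightarrow> 'b) \<Rightarrow> 'a set \<Rightarrow> ('a \<Rightarrow> 'b) \<Rightarrow> bool" where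
  "bounded_linear_on s1 s2 Z f \<longleftrightarrow>
     (\<forall>x\<in>Z. \<forall>y\<in>Z. f (x + y) = f x + f y) \<and>
     (\<forall>c. \<forall>x\<in>Z. f (s1 c x) = s2 c (f x)) \<and>
     (\<exists>B. \<forall>x\<in>Z. norm (f x) \<le> B * norm x)"

definition onorm_on :: "'a::real_normed_vector set \<Rightarrow> ('a \<Rightarrow> 'b::real_normed_vector) \<Rightarrow> real" where
  "onorm_on Z f = (SUP x\<in>Z. norm (f x) / norm x)"

lemma onorm_on_UNIV: "onorm_on UNIV f = onorm f"
  by (simp add: onorm_on_def onorm_def)

definition operators ::
  "('k::real_normed_field \<Rightarrow> 'a::real_normed_vector \<Rightarrow> 'a) \<Rightarrow> 'a set \<Rightarrow> ('a \<Rightarrow> 'a) set" where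
  "operators smul Z = {T. T ` Z \<subseteq> Z \<and> bounded_linear_on smul smul Z T}"

definition dual ::
  "('k::real_normed_field \<Rightarrow> 'a::real_normed_vector \<Rightarrow> 'a) \<Rightarrow> 'a set \<Rightarrow> ('a \<Rightarrow> 'k) set" where
  "dual smul Z = {f. bounded_linear_on smul (*) Z f}"

definition norming_functional ::
  "('k::real_normed_field \<Rightarrow> 'a::real_normed_vector \<Rightarrow> 'a) \<Rightarrow> 'a set \<Rightarrow> 'a \<Rightarrow> ('a \<Rightarrow> 'k) \<Rightarrow> bool" where
  "norming_functional smul Z z f \<longleftrightarrow>
     f \<in> dual smul Z \<and> onorm_on Z f = 1 \<and> f z = of_real (norm z)"

definition numerical_radius ::
  "('k::real_normed_field \<Rightarrow> 'a::real_normed_vector \<Rightarrow> 'a) \<Rightarrow> 'a set \<Rightarrow> ('a \<Rightarrow> 'a) \<Rightarrow> real" where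
  "numerical_radius smul Z T =
     Sup {norm (f (T x)) | x f.
       x \<in> Z \<and> norm x = 1 \<and> f \<in> dual smul Z \<and> onorm_on Z f = 1 \<and> f x = 1}"

definition numerical_index ::
  "('k::real_normed_field \<Rightarrow> 'a::real_normed_vector \<Rightarrow> 'a) \<Rightarrow> 'a set \<Rightarrow> real" where
  "numerical_index smul Z =
     Inf {numerical_radius smul Z T | T. T \<in> operators smul Z \<and> onorm_on Z T = 1}"

(* J is the range of the index j: the set {1..m} for operators on X_m, and {1..} for operators
   on the whole space. In both cases x and f range over the unit spheres of the whole space
   and its dual. *)
definition n1 ::
  "('k::real_normed_field \<Rightarrow> 'a::real_normed_vector \<Rightarrow> 'a) \<Rightarrow> (nat \<Rightarrow> 'a \<Rightarrow> 'a) \<Rightarrow>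
   nat set \<Rightarrow> ('a \<Rightarrow> 'a) \<Rightarrow> real" where
  "n1 smul P J L =
     Sup {norm (f (P j (L (P j x)))) | j x f.
       j \<in> J \<and> norm x = 1 \<and> f \<in> dual smul UNIV \<and> onorm_on UNIV f = 1 \<and> f x = 1}"

definition characterization_condition ::
  "('k::real_normed_field \<Rightarrow> 'a::real_normed_vector \<Rightarrow> 'a) \<Rightarrow> (nat \<Rightarrow> 'a set) \<Rightarrow>
   (nat \<Rightarrow> 'a \<Rightarrow> 'a) \<Rightarrow> bool" where
  "characterization_condition smul X P \<longleftrightarrow>
     (\<forall>x f m. norm x = 1 \<and> norming_functional smul UNIV x f \<and> m \<ge> 1 \<and> P m x \<noteq> 0 \<longrightarrow>
        (\<exists>b. norming_functional smul (X m) (P m x) (\<lambda>y. b * f y)))"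

end

(* A state of Z is a pair (x, f) of norm-one elements with f x = 1. A state (u, g) of X_m lifts
   to the state (u, g o P_m) of any larger space. Conversely, let (x, f) be a state of X with
   P_m x nonzero; by (CC) some multiple b f is norming for P_m x on X_m, and |b| >= 1 because
   ||f|| = 1. As ||P_m x|| <= 1, this bounds |f (P_m L P_m x)| by the numerical radius of L. Since
   P_m L P_m x tends to L x, (1) and (2) follow. For (3), replacing L on X_m by L P_m gives
   n(X) <= n(X_m), and compressing T to P_m T on X_m gives limsup n(X_m) <= n(X), because
   the norms of the compressions tend to ||T||.

   A real supremum over the empty set is a junk value, so every X_m must be known to have a
   state; this needs Hahn-Banach over both scalar fields. *)
theory Submission
  imports Defs
begin

section \<open>Norming functionals\<close>

definition sublinear :: "('a::real_vector \<Rightarrow> real) \<Rightarrow> bool" where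
  "sublinear p \<longleftrightarrow> (\<forall>x y. p (x + y) \<le> p x + p y) \<and> (\<forall>r\<ge>0. \<forall>x. p (r *\<^sub>R x) = r * p x)"

lemma sublinearD:
  assumes "sublinear p"
  shows "p (x + y) \<le> p x + p y" "r \<ge> 0 \<Longrightarrow> p (r *\<^sub>R x) = r * p x"
  using assms by (auto simp: sublinear_def)

lemma sublinear_zero:
  assumes "sublinear p"
  shows "p 0 = 0"
  using sublinearD(2)[OF assms, of 0 0] by simp

lemma sublinear_minus_ge:
  assumes "sublinear p"
  shows "- p (- x) \<le> p x"
  using sublinearD(1)[OF assms, of x "- x"] sublinear_zero[OF assms] by simp

text \<open>A minimal sublinear functional cannot be decreased in this way, so it is odd and hence
  linear. This gives the Hahn-Banach functional.\<close>

lemma sublinear_decrease: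
  assumes p: "sublinear p"
  obtains q where "sublinear q" "\<And>x. q x \<le> p x" "q (- z) \<le> - p z"
proof -
  \<comment> \<open>The infimum over \<open>t\<close> makes \<open>q\<close> linear along
    \<open>z\<close> with slope \<open>p z\<close>: \<open>t = 0\<close> gives
    \<open>q x \<le> p x\<close>, and \<open>t = 1\<close> at \<open>- z\<close> gives
    \<open>q (- z) \<le> p 0 - p z\<close>.\<close>
  define a where "a y t = p (y + t *\<^sub>R z) - t * p z" for y t
  define q where "q y = (INF t\<in>{0..}. a y t)" for y
  have lower: "- p (- y) \<le> a y t" if "t \<ge> 0" for y t
    using sublinearD(1)[OF p, of "y + t *\<^sub>R z" "- y"] sublinearD(2)[OF p that, of z]
    by (simp add: a_def)
  have bdd: "bdd_below (a y ` {0..})" for y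
    using lower by (intro bdd_belowI2) auto
  have le: "q y \<le> a y t" if "t \<ge> 0" for y t
    unfolding q_def using that by (intro cINF_lower bdd) auto
  have ge: "c \<le> q y" if "\<And>t. t \<ge> 0 \<Longrightarrow> c \<le> a y t" for c y
    unfolding q_def using that by (intro cINF_greatest) auto
  have sub: "q (x + y) \<le> q x + q y" for x y
  proof -
    \<comment> \<open>The two infima are taken one after the other: over \<open>t\<close> with
      \<open>s\<close> fixed, then over \<open>s\<close>.\<close>
    have "q (x + y) - q y \<le> a x s" if s: "s \<ge> 0" for s
    proof -
      have "q (x + y) - a x s \<le> a y t" if t: "t \<ge> 0" for t
      proof -
        have "q (x + y) \<le> a (x + y) (s + t)"
          using s t by (intro le) auto
        also have "\<dots> \<le> a x s + a y t"
          using sublinearD(1)[OF p, of "x + s *\<^sub>R z" "y + t *\<^sub>R z"]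
          by (simp add: a_def algebra_simps)
        finally show ?thesis by simp
      qed
      from ge[OF this] show ?thesis by simp
    qed
    from ge[OF this] show ?thesis by simp
  qed
  \<comment> \<open>One inequality is enough, since for the factor \<open>inverse r\<close> it
    yields the reverse one.\<close>
  have hom_le: "r * q y \<le> q (r *\<^sub>R y)" if r: "r > 0" for r y
  proof (rule ge)
    fix t :: real assume t: "t \<ge> 0"
    have "r * q y \<le> r * a y (t / r)"
      using le[of "t / r" y] r t by simp
    also have "\<dots> = a (r *\<^sub>R y) t"
      using sublinearD(2)[OF p, of r "y + (t / r) *\<^sub>R z"] r
      by (simp add: a_def algebra_simps)
    finally show "r * q y \<le> a (r *\<^sub>R y) t" .
  qed
  have q0: "q 0 = 0"
    using le[of 0 0] ge[of 0 0] sublinearD(2)[OF p] sublinear_zero[OF p]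
    by (force simp: a_def)
  have hom: "q (r *\<^sub>R y) = r * q y" if "r \<ge> 0" for r y
  proof (cases "r = 0")
    case False
    with that have r: "r > 0" by simp
    have "inverse r * q (r *\<^sub>R y) \<le> q y"
      using hom_le[of "inverse r" "r *\<^sub>R y"] r by simp
    hence "q (r *\<^sub>R y) \<le> r * q y"
      using r by (simp add: field_simps)
    with hom_le[OF r, of y] show ?thesis by simp
  qed (simp add: q0)
  show ?thesis
  proof
    show "sublinear q" using sub hom by (simp add: sublinear_def)
    show "q x \<le> p x" for x using le[of 0 x] by (simp add: a_def)
    show "q (- z) \<le> - p z"
      using le[of 1 "- z"] sublinear_zero[OF p] by (simp add: a_def)
  qed
qed

text \<open>Zorn's lemma for the reversed pointwise order. A nonempty chain is bounded by its
  pointwise infimum, which is finite because each member satisfies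
  \<open>p x \<ge> - p (- x) \<ge> - q (- x)\<close>.\<close>

lemma minimal_sublinear_below:
  fixes q :: "'a::real_vector \<Rightarrow> real"
  assumes q: "sublinear q"
  obtains p where "sublinear p" "p \<le> q" "\<And>p'. sublinear p' \<Longrightarrow> p' \<le> p \<Longrightarrow> p' = p"
proof -
  define A where "A = {p. sublinear p \<and> p \<le> q}"
  have "\<exists>m\<in>A. \<forall>a\<in>A. a \<le> m \<longrightarrow> a = m"
  proof (rule predicate_Zorn[where P = "\<lambda>p p'. p' \<le> p"])
    show "partial_order_on A (relation_of (\<lambda>p p'. p' \<le> p) A)"
      by (rule partial_order_on_relation_ofI) auto
  next
    fix C assume C: "C \<in> Chains (relation_of (\<lambda>p p'. p' \<le> p) A)"
    have CA: "C \<subseteq> A"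
      using C by (auto simp: Chains_def relation_of_def)
    have chain: "p \<le> p' \<or> p' \<le> p" if "p \<in> C" "p' \<in> C" for p p'
      using C that by (auto simp: Chains_def relation_of_def)
    show "\<exists>u\<in>A. \<forall>a\<in>C. u \<le> a"
    \<comment> \<open>The empty chain needs a bound too; an infimum over it would be meaningless, so
      \<open>q\<close> is used.\<close>
    proof (cases "C = {}")
      case True
      then show ?thesis using q by (auto simp: A_def)
    next
      case ne: False
      define u where "u x = (INF p\<in>C. p x)" for x
      have CS: "sublinear p" if "p \<in> C" for p
        using CA that by (auto simp: A_def)
      have bdd: "bdd_below ((\<lambda>p. p x) ` C)" for x
      proof (rule bdd_belowI2)
        fix p assume p: "p \<in> C"
        have "- q (- x) \<le> - p (- x)"
          using CA p by (auto simp: A_def le_fun_def)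
        with sublinear_minus_ge[OF CS[OF p], of x] show "- q (- x) \<le> p x" by simp
      qed
      have le: "u x \<le> p x" if "p \<in> C" for x p
        unfolding u_def using that by (intro cINF_lower bdd)
      have ge: "c \<le> u x" if "\<And>p. p \<in> C \<Longrightarrow> c \<le> p x" for c x
        unfolding u_def using that ne by (intro cINF_greatest) auto
      have sub: "u (x + y) \<le> u x + u y" for x y
      proof -
        have "u (x + y) - u y \<le> p x" if p: "p \<in> C" for p
        proof -
          have "u (x + y) - p x \<le> p' y" if p': "p' \<in> C" for p'
          proof -
            \<comment> \<open>An infimum of sublinear functionals need not be subadditive; the chain
              property helps by giving one \<open>w\<close> below both \<open>p\<close> and
              \<open>p'\<close>.\<close>
            obtain w where w: "w \<in> C" "w \<le> p" "w \<le> p'"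
              using chain[OF p p'] p p' by auto
            have "u (x + y) \<le> w (x + y)" using le w by auto
            also have "\<dots> \<le> w x + w y" using sublinearD(1)[OF CS[OF w(1)]] .
            also have "\<dots> \<le> p x + p' y" using w by (intro add_mono) (auto simp: le_fun_def)
            finally show ?thesis by simp
          qed
          then have "u (x + y) - p x \<le> u y" by (rule ge)
          then show ?thesis by simp
        qed
        then have "u (x + y) - u y \<le> u x" by (rule ge)
        then show ?thesis by simp
      qed
      have hom_le: "r * u x \<le> u (r *\<^sub>R x)" if "r \<ge> 0" for r x
      proof (rule ge)
        fix p assume p: "p \<in> C"
        show "r * u x \<le> p (r *\<^sub>R x)"
          using le[OF p, of x] sublinearD(2)[OF CS[OF p] that, of x] that
          by (simp add: mult_left_mono)
      qed
      have hom: "u (r *\<^sub>R x) = r * u x" if "r \<ge> 0" for r x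
      proof (cases "r = 0")
        case True
        have "(\<lambda>p. p 0) ` C = (\<lambda>p. 0) ` C"
          using sublinear_zero[OF CS] by (intro image_cong) auto
        then show ?thesis using ne by (simp add: u_def True)
      next
        case False
        with that have r: "r > 0" by simp
        have "inverse r * u (r *\<^sub>R x) \<le> u x"
          using hom_le[of "inverse r" "r *\<^sub>R x"] r by simp
        hence "u (r *\<^sub>R x) \<le> r * u x"
          using r by (simp add: field_simps)
        with hom_le[OF that, of x] show ?thesis by simp
      qed
      obtain p where p: "p \<in> C" using ne by auto
      have "u \<le> q"
        using le[OF p] CA p by (auto simp: A_def le_fun_def intro: order_trans)
      with sub hom have "u \<in> A" by (simp add: A_def sublinear_def)
      with le show ?thesis by (auto simp: le_fun_def)
    qed
  qed
  then obtain m where m: "m \<in> A" "\<And>a. a \<in> A \<Longrightarrow> a \<le> m \<Longrightarrow> a = m" by blast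
  show ?thesis
  proof
    show "sublinear m" "m \<le> q" using m(1) by (auto simp: A_def)
    show "p' = m" if "sublinear p'" "p' \<le> m" for p'
      using m that by (intro m(2)) (auto simp: A_def intro: order_trans)
  qed
qed

text \<open>The norm is first decreased in direction \<open>x0\<close>, and a minimal functional is
  then taken below the result. Minimality makes it linear, and the first decrease fixes its value at
  \<open>x0\<close>.\<close>

lemma real_norming_functional:
  fixes x0 :: "'a::real_normed_vector"
  obtains u where "linear u" "\<And>x. \<bar>u x\<bar> \<le> norm x" "u x0 = norm x0"
proof -
  have "sublinear (norm :: 'a \<Rightarrow> real)"
    by (simp add: sublinear_def norm_triangle_ineq)
  then obtain q where q: "sublinear q" "\<And>x::'a. q x \<le> norm x" "q (- x0) \<le> - norm x0"
    using sublinear_decrease[of norm x0] by metis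
  obtain p where p: "sublinear p" "p \<le> q" and min: "\<And>p'. sublinear p' \<Longrightarrow> p' \<le> p \<Longrightarrow> p' = p"
    using minimal_sublinear_below[OF q(1)] by metis
  \<comment> \<open>Decreasing \<open>p\<close> at \<open>z\<close> must return \<open>p\<close>
    itself, so \<open>p (- z) \<le> - p z\<close>.\<close>
  have minus: "p (- z) = - p z" for z
  proof -
    obtain p' where p': "sublinear p'" "\<And>x. p' x \<le> p x" "p' (- z) \<le> - p z"
      using sublinear_decrease[OF p(1)] by metis
    have "p' = p" using p' by (intro min) (auto simp: le_fun_def)
    with p'(3) sublinear_minus_ge[OF p(1), of z] show ?thesis by simp
  qed
  \<comment> \<open>Subadditivity at \<open>- x\<close>, \<open>- y\<close> becomes superadditivity
    at \<open>x\<close>, \<open>y\<close> by oddness.\<close>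
  have add: "p (x + y) = p x + p y" for x y
    using sublinearD(1)[OF p(1), of x y] sublinearD(1)[OF p(1), of "- x" "- y"]
      minus[of "x + y"] minus[of x] minus[of y] by simp
  have scale: "p (r *\<^sub>R x) = r * p x" for r x
    using sublinearD(2)[OF p(1), of r x] sublinearD(2)[OF p(1), of "- r" x] minus[of "r *\<^sub>R x"]
    by (cases "r \<ge> 0") auto
  have le: "p x \<le> norm x" for x
    using p(2) q(2)[of x] by (auto simp: le_fun_def intro: order_trans)
  show ?thesis
  proof
    show "linear p" using add scale by (intro linearI) auto
    show "\<bar>p x\<bar> \<le> norm x" for x
      using le[of x] le[of "- x"] minus[of x] by simp
    have "p (- x0) \<le> q (- x0)" using p(2) by (simp add: le_fun_def)
    then show "p x0 = norm x0" using q(3) le[of x0] minus[of x0] by simp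
  qed
qed

section \<open>The scalar field as a copy of the real or complex numbers\<close>

text \<open>The map fixes the rationals by algebra, and the reals by density because it preserves
  the norm. Thus the \<open>of_real\<close> of the abstract field corresponds to that of the
  concrete one.\<close>

lemma field_isometry_of_real:
  fixes \<phi> :: "'k::real_normed_field \<Rightarrow> 'l::real_normed_field"
  assumes inj: "inj \<phi>" and add: "\<And>x y. \<phi> (x + y) = \<phi> x + \<phi> y"
    and mult: "\<And>x y. \<phi> (x * y) = \<phi> x * \<phi> y" and norm: "\<And>x. norm (\<phi> x) = norm x"
  shows "\<phi> (of_real r) = of_real r"
proof -
  interpret additive \<phi> by unfold_locales (rule add)
  \<comment> \<open>\<open>\<phi> 1\<close> is idempotent of norm 1, hence not 0.\<close>
  have one: "\<phi> 1 = 1"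
    using mult[of 1 1] norm[of 1] by auto
  have nat: "\<phi> (of_nat n) = of_nat n" for n
    by (induction n) (auto simp: zero add one)
  have int: "\<phi> (of_int i) = of_int i" for i
    by (cases i rule: int_cases2) (auto simp: nat minus)
  have rat: "\<phi> (of_real (of_rat q)) = of_real (of_rat q)" for q
  proof -
    obtain a b where q: "q = of_int a / of_int b" "b > 0"
      by (metis Fract_of_int_quotient Rat_cases)
    have "of_int b * \<phi> (of_real (of_rat q)) = \<phi> (of_int b * of_real (of_rat q))"
      by (simp add: mult int)
    also have "of_int b * of_real (of_rat q) = (of_int a :: 'k)"
      using q by (simp add: of_rat_divide)
    also have "\<phi> (of_int a) = of_int b * of_real (of_rat q)"
      using q by (simp add: int of_rat_divide)
    finally show ?thesis
      using q by simp
  qed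
  have "norm (\<phi> (of_real r) - of_real r) \<le> e" if "e > 0" for e
  proof -
    obtain q where "r - e / 2 < of_rat q" "of_rat q < r + e / 2"
      using of_rat_dense[of "r - e / 2" "r + e / 2"] \<open>e > 0\<close> by auto
    then have q: "\<bar>r - of_rat q\<bar> < e / 2" by linarith
    have "\<phi> (of_real r) - of_real r = \<phi> (of_real (r - of_rat q)) - of_real (r - of_rat q)"
      by (simp add: diff rat)
    also have "norm \<dots> \<le> norm (\<phi> (of_real (r - of_rat q))) + norm (of_real (r - of_rat q) :: 'l)"
      by (rule norm_triangle_ineq4)
    also have "\<dots> = 2 * \<bar>r - of_rat q\<bar>"
      by (simp only: norm norm_of_real mult_2)
    finally show ?thesis using q by simp
  qed
  then have "norm (\<phi> (of_real r) - of_real r) \<le> 0"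
    by (rule field_le_epsilon[where y = 0, simplified])
  then show ?thesis by simp
qed

text \<open>The isomorphisms of the class axiom are replaced by statements inside the field:
  \<open>J\<close> is the preimage of the imaginary unit, and the norm is the complex modulus in the
  coordinates \<open>a\<close>, \<open>b\<close>.\<close>

lemma scalar_cases:
  obtains (real) "\<And>c::'k::real_or_complex. c \<in> range of_real"
  | (complex) J :: "'k::real_or_complex" where "J * J = - 1"
      "\<And>c. \<exists>a b. c = of_real a + J * of_real b"
      "\<And>a b. norm (of_real a + J * of_real b) = sqrt (a\<^sup>2 + b\<^sup>2)"
  using real_or_complex[where 'a = 'k]
proof (elim disjE exE conjE)
  fix \<phi> :: "'k \<Rightarrow> real"
  assume \<phi>: "bij \<phi>" "\<forall>x y. \<phi> (x + y) = \<phi> x + \<phi> y" "\<forall>x y. \<phi> (x * y) = \<phi> x * \<phi> y"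
    "\<forall>x. norm (\<phi> x) = norm x"
  have "\<phi> (of_real r) = of_real r" for r
    using \<phi> by (intro field_isometry_of_real) (auto simp: bij_def)
  then have "c = of_real (\<phi> c)" for c
    using \<phi>(1) by (intro injD[of \<phi>]) (auto simp: bij_def)
  then show thesis by (intro real) blast
next
  fix \<phi> :: "'k \<Rightarrow> complex"
  assume \<phi>: "bij \<phi>" "\<forall>x y. \<phi> (x + y) = \<phi> x + \<phi> y" "\<forall>x y. \<phi> (x * y) = \<phi> x * \<phi> y"
    "\<forall>x. norm (\<phi> x) = norm x"
  have of_real: "\<phi> (of_real r) = of_real r" for r
    using \<phi> by (intro field_isometry_of_real) (auto simp: bij_def)
  obtain J where J: "\<phi> J = \<i>" using \<phi>(1) by (metis bij_pointE)
  have eq: "c = d" if "\<phi> c = \<phi> d" for c d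
    using \<phi>(1) that by (auto simp: bij_def dest: injD)
  have "J * J = of_real (- 1)"
    by (rule eq, subst of_real) (simp add: \<phi> J)
  then have "J * J = - 1" by simp
  moreover have "c = of_real (Re (\<phi> c)) + J * of_real (Im (\<phi> c))" for c
    by (rule eq) (simp add: \<phi> J of_real complex_eq_iff)
  moreover have "norm (of_real a + J * of_real b) = sqrt (a\<^sup>2 + b\<^sup>2)" for a b
  proof -
    have "norm (of_real a + J * of_real b) = norm (\<phi> (of_real a + J * of_real b))"
      by (simp only: \<phi>(4))
    also have "\<phi> (of_real a + J * of_real b) = Complex a b"
      by (simp add: \<phi> J of_real complex_eq_iff)
    finally show ?thesis by (simp add: complex_norm)
  qed
  ultimately show thesis by (intro complex) blast+
qed

section \<open>Operator norms, states and the numerical radius\<close>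

lemma dualI:
  assumes "\<And>x y. x \<in> Z \<Longrightarrow> y \<in> Z \<Longrightarrow> f (x + y) = f x + f y"
    and "\<And>c x. x \<in> Z \<Longrightarrow> f (smul c x) = c * f x"
    and "\<And>x. x \<in> Z \<Longrightarrow> norm (f x) \<le> B * norm x"
  shows "f \<in> dual smul Z"
  unfolding dual_def bounded_linear_on_def using assms by blast

lemma operatorsI:
  assumes "\<And>x. x \<in> Z \<Longrightarrow> T x \<in> Z"
    and "\<And>x y. x \<in> Z \<Longrightarrow> y \<in> Z \<Longrightarrow> T (x + y) = T x + T y"
    and "\<And>c x. x \<in> Z \<Longrightarrow> T (smul c x) = smul c (T x)"
    and "\<And>x. x \<in> Z \<Longrightarrow> norm (T x) \<le> B * norm x"
  shows "T \<in> operators smul Z"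
  unfolding operators_def bounded_linear_on_def using assms by blast

lemma dualD:
  assumes "f \<in> dual smul Z"
  shows "x \<in> Z \<Longrightarrow> y \<in> Z \<Longrightarrow> f (x + y) = f x + f y"
    and "x \<in> Z \<Longrightarrow> f (smul c x) = c * f x"
  using assms by (auto simp: dual_def bounded_linear_on_def)

lemma operatorsD:
  assumes "T \<in> operators smul Z"
  shows "x \<in> Z \<Longrightarrow> T x \<in> Z"
    and "x \<in> Z \<Longrightarrow> y \<in> Z \<Longrightarrow> T (x + y) = T x + T y"
    and "x \<in> Z \<Longrightarrow> T (smul c x) = smul c (T x)"
  using assms by (auto simp: operators_def bounded_linear_on_def)

lemma onorm_on_bdd_above:
  assumes "bounded_linear_on s1 s2 Z f"
  shows "bdd_above ((\<lambda>z. norm (f z) / norm z) ` Z)"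
proof -
  obtain B where B: "\<And>x. x \<in> Z \<Longrightarrow> norm (f x) \<le> B * norm x"
    using assms unfolding bounded_linear_on_def by blast
  show ?thesis
  proof (rule bdd_aboveI2)
    fix x assume "x \<in> Z"
    then have "norm (f x) \<le> B * norm x" by (rule B)
    \<comment> \<open>The constant \<open>B\<close> may be negative if \<open>Z\<close> is trivial,
      while the quotient at 0 is 0 because division by 0 gives 0.\<close>
    also have "\<dots> \<le> max B 0 * norm x" by (intro mult_right_mono) auto
    finally show "norm (f x) / norm x \<le> max B 0"
      by (cases "x = 0") (auto simp: field_simps)
  qed
qed

lemma onorm_on_ge:
  assumes "bounded_linear_on s1 s2 Z f" "z \<in> Z"
  shows "norm (f z) / norm z \<le> onorm_on Z f"
  unfolding onorm_on_def using assms(2) by (intro cSUP_upper onorm_on_bdd_above[OF assms(1)])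

lemma onorm_on_bound:
  assumes f: "bounded_linear_on s1 s2 Z f" and z: "z \<in> Z"
  shows "norm (f z) \<le> onorm_on Z f * norm z"
proof (cases "z = 0")
  case True
  obtain B where "norm (f z) \<le> B * norm z"
    using f z by (auto simp: bounded_linear_on_def)
  then show ?thesis by (simp add: True)
next
  case False
  then show ?thesis using onorm_on_ge[OF assms] by (simp add: field_simps)
qed

lemma onorm_on_le:
  assumes "Z \<noteq> {}" "b \<ge> 0" "\<And>z. z \<in> Z \<Longrightarrow> norm (f z) \<le> b * norm z"
  shows "onorm_on Z f \<le> b"
  unfolding onorm_on_def
proof (rule cSUP_least)
  fix z assume "z \<in> Z"
  with assms show "norm (f z) / norm z \<le> b"
    by (cases "z = 0") (auto simp: field_simps)
qed (rule assms)

lemma onorm_on_nonneg: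
  assumes "bounded_linear_on s1 s2 Z f" "Z \<noteq> {}"
  shows "0 \<le> onorm_on Z f"
proof -
  obtain z where "z \<in> Z" using assms by auto
  from onorm_on_ge[OF assms(1) this] show ?thesis
    by (rule order_trans[rotated]) simp
qed

text \<open>The side conditions of \<open>numerical_radius\<close> become an index set, so that
  \<open>numerical_radius\<close> and \<open>n1\<close> are indexed suprema and the
  \<open>cSUP\<close> rules apply.\<close>

definition states ::
  "('k::real_normed_field \<Rightarrow> 'a::real_normed_vector \<Rightarrow> 'a) \<Rightarrow> 'a set \<Rightarrow> ('a \<times> ('a \<Rightarrow> 'k)) set" where
  "states smul Z =
     {(x, f). x \<in> Z \<and> norm x = 1 \<and> f \<in> dual smul Z \<and> onorm_on Z f = 1 \<and> f x = 1}"

lemma numerical_radius_eq: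
  "numerical_radius smul Z T = (SUP (x, f)\<in>states smul Z. norm (f (T x)))"
  unfolding numerical_radius_def states_def by (intro arg_cong[where f = Sup]) auto

lemma n1_eq:
  "n1 smul P J L = (SUP (j, x, f)\<in>J \<times> states smul UNIV. norm (f (P j (L (P j x)))))"
  unfolding n1_def states_def by (intro arg_cong[where f = Sup]) force

text \<open>The bound gives norm at most 1, and the value 1 at the unit vector \<open>x\<close>
  gives at least 1.\<close>

lemma statesI:
  assumes x: "x \<in> Z" "norm x = 1" "f x = 1"
    and f: "f \<in> dual smul Z" "\<And>y. y \<in> Z \<Longrightarrow> norm (f y) \<le> norm y"
  shows "(x, f) \<in> states smul Z"
proof -
  have "onorm_on Z f \<le> 1"
    using x f by (intro onorm_on_le) auto
  moreover have "1 \<le> onorm_on Z f"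
    using onorm_on_ge[of smul "(*)" Z f x] x f by (simp add: dual_def)
  ultimately show ?thesis using x f by (simp add: states_def)
qed

lemma statesD:
  assumes "(x, f) \<in> states smul Z"
  shows "x \<in> Z" "norm x = 1" "f \<in> dual smul Z" "f x = 1" "onorm_on Z f = 1"
    and "y \<in> Z \<Longrightarrow> norm (f y) \<le> norm y"
  using assms onorm_on_bound[of smul "(*)" Z f y] by (auto simp: states_def dual_def)

text \<open>All values are at most the operator norm of \<open>T\<close>, so the supremum is over a
  bounded set.\<close>

lemma numerical_radius_upper:
  assumes T: "T \<in> operators smul Z" and s: "(x, f) \<in> states smul Z"
  shows "norm (f (T x)) \<le> numerical_radius smul Z T"
proof -
  have b: "bounded_linear_on smul smul Z T" using T by (simp add: operators_def)
  have "bdd_above ((\<lambda>(x, f). norm (f (T x))) ` states smul Z)"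
  proof (rule bdd_aboveI2)
    fix p assume "p \<in> states smul Z"
    then obtain y g where p: "p = (y, g)" "(y, g) \<in> states smul Z" by (cases p) auto
    have "norm (g (T y)) \<le> norm (T y)"
      using operatorsD(1)[OF T] statesD(1)[OF p(2)] by (intro statesD(6)[OF p(2)]) auto
    also have "\<dots> \<le> onorm_on Z T * norm y"
      using p by (intro onorm_on_bound[OF b] statesD)
    finally show "(case p of (x, f) \<Rightarrow> norm (f (T x))) \<le> onorm_on Z T"
      using p by (simp add: statesD(2)[OF p(2)])
  qed
  from cSUP_upper[OF s this] show ?thesis by (simp add: numerical_radius_eq)
qed

lemma numerical_radius_le:
  assumes "states smul Z \<noteq> {}" "\<And>x f. (x, f) \<in> states smul Z \<Longrightarrow> norm (f (T x)) \<le> c"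
  shows "numerical_radius smul Z T \<le> c"
  unfolding numerical_radius_eq using assms by (intro cSUP_least) auto

lemma numerical_radius_nonneg:
  assumes "T \<in> operators smul Z" "states smul Z \<noteq> {}"
  shows "0 \<le> numerical_radius smul Z T"
proof -
  obtain x f where "(x, f) \<in> states smul Z" using assms(2) by auto
  from numerical_radius_upper[OF assms(1) this] show ?thesis
    by (rule order_trans[rotated]) simp
qed

section \<open>Existence of states over both scalar fields, and the numerical index\<close>

context banach_space_over
begin

lemma scale_inverse_norm:
  assumes "x \<noteq> 0"
  shows "norm (smul (of_real (inverse (norm x))) x) = 1"
    and "smul (of_real (norm x)) (smul (of_real (inverse (norm x))) x) = x"
  using assms by (auto simp: norm_scale scale_of_real norm_inverse)

text \<open>A real-linear norming functional \<open>u\<close> is made linear over the field. For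
  real scalars it is so already; for complex ones it becomes the real part of a complex-linear
  functional.\<close>

lemma norming_functional_exists:
  obtains f where "f \<in> dual smul UNIV" "\<And>y. norm (f y) \<le> norm y" "f x = of_real (norm x)"
proof -
  obtain u where u: "linear u" "\<And>y. \<bar>u y\<bar> \<le> norm y" "u x = norm x"
    using real_norming_functional[of x] by blast
  have u_add: "u (y + z) = u y + u z" for y z using u(1) by (rule linear_add)
  have u_scale: "u (smul (of_real r) y) = r * u y" for r y
    using u(1) by (simp add: scale_of_real linear_scale)
  show thesis
  proof (cases rule: scalar_cases[where 'k = 'k])
    case real
    have scale: "of_real (u (smul c y)) = c * of_real (u y)" for c y
    proof -
      obtain r where "c = of_real r" using real[of c] by auto
      then show ?thesis by (simp add: u_scale)
    qed
    show thesis
    proof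
      show "(\<lambda>y. of_real (u y)) \<in> dual smul UNIV"
        using u by (intro dualI[where B = 1]) (auto simp: u_add scale)
    qed (use u in auto)
  next
    case (complex J)
    \<comment> \<open>The only functional linear over the field with real part
      \<open>u\<close>.\<close>
    define f where "f y = of_real (u y) - J * of_real (u (smul J y))" for y
    have add: "f (y + z) = f y + f z" for y z
      by (simp add: f_def u_add scale_right_distrib algebra_simps)
    have norm_ge: "\<bar>u y\<bar> \<le> norm (f y)" for y
      using complex(3)[of "u y" "- u (smul J y)"] by (simp add: f_def real_le_rsqrt)
    have scale_real: "f (smul (of_real r) y) = of_real r * f y" for r y
    proof -
      have "smul J (smul (of_real r) y) = smul (of_real r) (smul J y)"
        by (simp add: mult.commute)
      then show ?thesis by (simp only: f_def u_scale) (simp add: algebra_simps)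
    qed
    have scale_J: "f (smul J y) = J * f y" for y
    proof -
      have "smul J (smul J y) = smul (of_real (- 1)) y" using complex(1) by simp
      then have "u (smul J (smul J y)) = - u y" by (simp only: u_scale)
      then show ?thesis using complex(1) by (simp add: f_def right_diff_distrib flip: mult.assoc)
    qed
    have scale: "f (smul c y) = c * f y" for c y
    proof -
      obtain a b where c: "c = of_real a + J * of_real b" using complex(2) by blast
      have "smul c y = smul (of_real a) y + smul J (smul (of_real b) y)"
        by (simp add: c scale_left_distrib)
      then show ?thesis by (simp only: add scale_real scale_J) (simp add: c algebra_simps)
    qed
    \<comment> \<open>Where \<open>f\<close> takes a nonnegative real value, that value is its real
      part \<open>u\<close>.\<close>
    have re: "norm (f y) = u y" if fy: "f y = of_real (norm (f y))" for y
    proof -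
      have "norm (of_real (u y - norm (f y)) + J * of_real (- u (smul J y))) = 0"
        using fy by (simp add: f_def)
      then have "u y - norm (f y) = 0"
        unfolding complex(3) by (simp add: sum_power2_eq_zero_iff)
      then show ?thesis by simp
    qed
    have le: "norm (f y) \<le> norm y" for y
    proof (cases "f y = 0")
      case False
      \<comment> \<open>The unimodular scalar \<open>c\<close> rotates \<open>f y\<close> onto the
        nonnegative reals, where the bound on \<open>u\<close> applies.\<close>
      define c where "c = of_real (norm (f y)) / f y"
      have c: "norm c = 1" using False by (simp add: c_def norm_divide)
      have "f (smul c y) = of_real (norm (f y))" using False by (simp add: scale c_def)
      then have "norm (f y) = u (smul c y)" using re[of "smul c y"] by simp
      also have "\<dots> \<le> norm (smul c y)" using u(2)[of "smul c y"] by simp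
      finally show ?thesis by (simp add: norm_scale c)
    qed simp
    \<comment> \<open>The real part alone already has modulus \<open>norm x\<close>, so no room is
      left for an imaginary part.\<close>
    have "(norm (f x))\<^sup>2 = (norm x)\<^sup>2 + (u (smul J x))\<^sup>2"
      using complex(3)[of "u x" "- u (smul J x)"] by (simp add: f_def u(3))
    moreover have "(norm (f x))\<^sup>2 \<le> (norm x)\<^sup>2" using le by (intro power_mono) auto
    ultimately have "u (smul J x) = 0" by simp
    then have "f x = of_real (norm x)" by (simp add: f_def u(3))
    with le show thesis
      using add scale by (intro that[of f] dualI[where B = 1]) auto
  qed
qed

text \<open>The normalised \<open>z\<close> is paired with a norming functional of the whole space;
  its restriction to \<open>Z\<close> keeps norm 1 since the vector lies in
  \<open>Z\<close>.\<close>

lemma states_nonempty: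
  assumes Z: "subspace Z" "z \<in> Z" "z \<noteq> 0"
  shows "states smul Z \<noteq> {}"
proof -
  define x where "x = smul (of_real (inverse (norm z))) z"
  have x: "x \<in> Z" "norm x = 1"
    using Z scale_inverse_norm(1) by (auto simp: x_def subspace_scale)
  obtain f where f: "f \<in> dual smul UNIV" "\<And>y. norm (f y) \<le> norm y" "f x = of_real (norm x)"
    using norming_functional_exists by blast
  have "f \<in> dual smul Z" using f(1) by (auto simp: dual_def bounded_linear_on_def)
  with f x have "(x, f) \<in> states smul Z" by (intro statesI) auto
  then show ?thesis by blast
qed

text \<open>A state exists, so the radii are nonnegative and the infimum is over a set bounded
  below.\<close>

lemma numerical_index_le:
  assumes "subspace Z" "z \<in> Z" "z \<noteq> 0" "T \<in> operators smul Z" "onorm_on Z T = 1"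
  shows "numerical_index smul Z \<le> numerical_radius smul Z T"
  unfolding numerical_index_def
proof (rule cInf_lower)
  show "bdd_below {numerical_radius smul Z T |T. T \<in> operators smul Z \<and> onorm_on Z T = 1}"
    using numerical_radius_nonneg states_nonempty[OF assms(1-3)] by (intro bdd_belowI[of _ 0]) auto
qed (use assms in auto)

text \<open>The identity is a witness; it has norm 1 because \<open>Z\<close> contains a nonzero
  vector.\<close>

lemma numerical_index_set_nonempty:
  assumes "z \<in> Z" "z \<noteq> 0"
  shows "{numerical_radius smul Z T |T. T \<in> operators smul Z \<and> onorm_on Z T = 1} \<noteq> {}"
proof -
  have id: "(\<lambda>x. x) \<in> operators smul Z" by (rule operatorsI[where B = 1]) auto
  have "onorm_on Z (\<lambda>x. x) \<le> 1" using assms by (intro onorm_on_le) auto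
  moreover have "1 \<le> onorm_on Z (\<lambda>x. x)"
    using onorm_on_ge[of smul smul Z "\<lambda>x. x" z] id assms by (simp add: operators_def)
  ultimately have "onorm_on Z (\<lambda>x. x) = 1" by simp
  with id show ?thesis by blast
qed

lemma numerical_index_nonneg:
  assumes "subspace Z" "z \<in> Z" "z \<noteq> 0"
  shows "0 \<le> numerical_index smul Z"
  unfolding numerical_index_def
  using numerical_radius_nonneg states_nonempty[OF assms] numerical_index_set_nonempty[OF assms(2,3)]
  by (intro cInf_greatest) auto

text \<open>Both sides are homogeneous in \<open>T\<close>, so \<open>T\<close> may be scaled to
  norm 1 unless its norm is 0, where the left side vanishes.\<close>

lemma numerical_index_mult_le:
  assumes Z: "subspace Z" "z \<in> Z" "z \<noteq> 0" and T: "T \<in> operators smul Z"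
  shows "numerical_index smul Z * onorm_on Z T \<le> numerical_radius smul Z T"
proof -
  define s where "s = onorm_on Z T"
  have b: "bounded_linear_on smul smul Z T" using T by (simp add: operators_def)
  have ne: "states smul Z \<noteq> {}" by (rule states_nonempty) fact+
  have "0 \<le> s" unfolding s_def by (rule onorm_on_nonneg[OF b]) (use Z in auto)
  show ?thesis
  proof (cases "s = 0")
    case True
    then show ?thesis using numerical_radius_nonneg[OF T ne] by (simp add: s_def)
  next
    case False
    with \<open>0 \<le> s\<close> have s: "s > 0" by simp
    define S where "S x = smul (of_real (inverse s)) (T x)" for x
    have norm_S: "norm (S x) = norm (T x) / s" for x
      using s by (simp add: S_def norm_scale norm_inverse divide_inverse mult.commute)
    have S: "S \<in> operators smul Z"
    proof (rule operatorsI)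
      show "norm (S x) \<le> 1 * norm x" if "x \<in> Z" for x
        using onorm_on_bound[OF b that] s by (simp add: norm_S field_simps s_def)
      show "S (smul c x) = smul c (S x)" if "x \<in> Z" for c x
        using operatorsD(3)[OF T that] by (simp add: S_def mult.commute)
    qed (use Z T in \<open>auto simp: S_def operatorsD subspace_scale scale_right_distrib\<close>)
    have S_le: "onorm_on Z S \<le> 1"
      using onorm_on_bound[OF b] s Z by (intro onorm_on_le) (auto simp: norm_S field_simps s_def)
    have "s \<le> s * onorm_on Z S"
      unfolding s_def
    proof (rule onorm_on_le)
      have bS: "bounded_linear_on smul smul Z S" using S by (simp add: operators_def)
      show "0 \<le> onorm_on Z T * onorm_on Z S"
        using onorm_on_nonneg[OF bS] Z s by (auto simp: s_def intro!: mult_nonneg_nonneg)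
      show "norm (T x) \<le> onorm_on Z T * onorm_on Z S * norm x" if "x \<in> Z" for x
        using onorm_on_bound[OF bS that] s by (simp add: norm_S s_def field_simps)
    qed (use Z in auto)
    with s S_le have "onorm_on Z S = 1" by simp
    then have "numerical_index smul Z \<le> numerical_radius smul Z S"
      using Z S by (intro numerical_index_le)
    also have "\<dots> \<le> numerical_radius smul Z T / s"
    proof (rule numerical_radius_le[OF ne])
      fix x f assume xf: "(x, f) \<in> states smul Z"
      have "f (S x) = of_real (inverse s) * f (T x)"
        unfolding S_def
        by (rule dualD(2)[OF statesD(3)[OF xf] operatorsD(1)[OF T statesD(1)[OF xf]]])
      then have "norm (f (S x)) = norm (f (T x)) / s"
        using s by (simp add: norm_mult norm_inverse divide_inverse mult.commute)
      then show "norm (f (S x)) \<le> numerical_radius smul Z T / s"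
        using numerical_radius_upper[OF T xf] s by (simp add: divide_right_mono)
    qed
    finally show ?thesis using s by (simp add: s_def field_simps)
  qed
qed

end

section \<open>Norm-one projections with the Characterization Condition\<close>

locale projection_scheme = banach_space_over smul
  for smul :: "'k::real_or_complex \<Rightarrow> 'a::banach \<Rightarrow> 'a" +
  fixes X :: "nat \<Rightarrow> 'a set" and P :: "nat \<Rightarrow> 'a \<Rightarrow> 'a"
  assumes subspace_X: "m \<ge> 1 \<Longrightarrow> subspace (X m)"
    and X_Suc: "m \<ge> 1 \<Longrightarrow> X m \<subseteq> X (Suc m)"
    and X_dense: "closure (\<Union>m\<in>{1..}. X m) = UNIV"
    and P_operator: "m \<ge> 1 \<Longrightarrow> P m \<in> operators smul UNIV"
    and P_range: "m \<ge> 1 \<Longrightarrow> range (P m) = X m"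
    and P_idem: "m \<ge> 1 \<Longrightarrow> P m (P m x) = P m x"
    and P_onorm: "m \<ge> 1 \<Longrightarrow> onorm (P m) = 1"
    and CC: "characterization_condition smul X P"
begin

lemma X_mono:
  assumes "1 \<le> j" "j \<le> m"
  shows "X j \<subseteq> X m"
  using assms(2)
proof (induction rule: dec_induct)
  case (step n)
  with assms(1) X_Suc[of n] show ?case by auto
qed simp

lemma P_in_X: "m \<ge> 1 \<Longrightarrow> P m x \<in> X m"
  using P_range by blast

lemma P_fixes: "m \<ge> 1 \<Longrightarrow> x \<in> X m \<Longrightarrow> P m x = x"
  using P_range P_idem by (metis imageE)

lemma P_add: "m \<ge> 1 \<Longrightarrow> P m (x + y) = P m x + P m y"
  using operatorsD(2)[OF P_operator] by simp

lemma P_scale: "m \<ge> 1 \<Longrightarrow> P m (smul c x) = smul c (P m x)"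
  using operatorsD(3)[OF P_operator] by simp

lemma P_diff:
  assumes "m \<ge> 1"
  shows "P m (x - y) = P m x - P m y"
  using P_add[OF assms, of "x - y" y] by simp

lemma P_norm_le:
  assumes "m \<ge> 1"
  shows "norm (P m x) \<le> norm x"
  using onorm_on_bound[of smul smul UNIV "P m" x] P_operator[OF assms] P_onorm[OF assms]
  by (simp add: operators_def onorm_on_UNIV)

lemma X_nontrivial:
  assumes "m \<ge> 1"
  obtains z where "z \<in> X m" "z \<noteq> 0"
proof -
  have "P m \<noteq> (\<lambda>x. 0)"
    using P_onorm[OF assms] by (auto simp: onorm_zero)
  then show ?thesis using that P_in_X[OF assms] by fastforce
qed

lemma states_X_nonempty: "m \<ge> 1 \<Longrightarrow> states smul (X m) \<noteq> {}"
  using X_nontrivial subspace_X states_nonempty by metis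

lemma states_UNIV_nonempty: "states smul UNIV \<noteq> {}"
  using X_nontrivial[of 1] states_nonempty[of UNIV] subspace_UNIV by (metis UNIV_I order_refl)

section \<open>Pointwise convergence of the projections and of compressed operators\<close>

text \<open>A nearby \<open>y\<close> in some \<open>X n\<close> is fixed by every
  \<open>P m\<close> with \<open>m \<ge> n\<close>, and \<open>P m\<close> does not enlarge the
  error \<open>x - y\<close>.\<close>

lemma P_tendsto: "(\<lambda>m. P m x) \<longlonglongrightarrow> x"
proof (rule LIMSEQ_I)
  fix e :: real assume e: "e > 0"
  have "x \<in> closure (\<Union>m\<in>{1..}. X m)" by (simp only: X_dense UNIV_I)
  with e obtain y n where y: "n \<ge> 1" "y \<in> X n" "dist y x < e / 2"
    unfolding closure_approachable by (metis UN_E atLeast_iff half_gt_zero)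
  have "norm (P m x - x) < e" if m: "m \<ge> n" for m
  proof -
    have m1: "m \<ge> 1" using m y by simp
    have "P m y = y" using X_mono[OF y(1) m] y(2) by (intro P_fixes[OF m1]) auto
    then have "P m x - x = P m (x - y) + (y - x)" by (simp add: P_diff[OF m1])
    then have "norm (P m x - x) \<le> norm (P m (x - y)) + norm (y - x)"
      by (metis norm_triangle_ineq)
    also have "\<dots> \<le> norm (x - y) + norm (y - x)"
      using P_norm_le[OF m1] by simp
    also have "\<dots> < e" using y(3) by (simp add: dist_norm norm_minus_commute)
    finally show ?thesis .
  qed
  then show "\<exists>no. \<forall>m\<ge>no. norm (P m x - x) < e" by blast
qed

lemma operator_tendsto:
  assumes T: "T \<in> operators smul UNIV" and y: "(y \<longlongrightarrow> x) sequentially"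
  shows "(\<lambda>m. T (y m)) \<longlonglongrightarrow> T x"
proof -
  obtain B where B: "\<And>z. norm (T z) \<le> B * norm z"
    using T by (auto simp: operators_def bounded_linear_on_def)
  have diff: "T (z - w) = T z - T w" for z w
    using operatorsD(2)[OF T, of "z - w" w] by simp
  have "(\<lambda>m. T (y m) - T x) \<longlonglongrightarrow> 0"
  proof (rule Lim_null_comparison)
    show "\<forall>\<^sub>F m in sequentially. norm (T (y m) - T x) \<le> B * norm (y m - x)"
      using B by (simp flip: diff)
    show "(\<lambda>m. B * norm (y m - x)) \<longlonglongrightarrow> 0"
      using y by (intro tendsto_mult_right_zero tendsto_norm_zero) (simp add: LIM_zero)
  qed
  then show ?thesis by (rule LIM_zero_cancel)
qed

text \<open>Since \<open>P m\<close> is a contraction, replacing \<open>T (P m x)\<close> by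
  \<open>T x\<close> inside it costs at most their distance, which tends to 0.\<close>

lemma compression_tendsto:
  assumes T: "T \<in> operators smul UNIV"
  shows "(\<lambda>m. P m (T (P m x))) \<longlonglongrightarrow> T x"
proof -
  have "(\<lambda>m. P m (T (P m x)) - P m (T x)) \<longlonglongrightarrow> 0"
  proof (rule Lim_null_comparison)
    show "\<forall>\<^sub>F m in sequentially. norm (P m (T (P m x)) - P m (T x)) \<le> norm (T (P m x) - T x)"
      \<comment> \<open>Indices start at 1 and \<open>P 0\<close> is arbitrary, so the estimate
        holds only eventually.\<close>
      using eventually_ge_at_top[of 1] by eventually_elim (simp add: P_norm_le flip: P_diff)
    show "(\<lambda>m. norm (T (P m x) - T x)) \<longlonglongrightarrow> 0"
      using operator_tendsto[OF T P_tendsto[of x]] by (intro tendsto_norm_zero) (simp add: LIM_zero)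
  qed
  from tendsto_add[OF this P_tendsto[of "T x"]] show ?thesis by simp
qed

section \<open>Passing states between \<open>X m\<close> and larger spaces\<close>

text \<open>\<open>P m\<close> is a contraction fixing \<open>x\<close>, so composing with it keeps
  both the norm bound and the value at \<open>x\<close>. The set \<open>Z\<close> stands for the
  whole space or for a later \<open>X n\<close>.\<close>

lemma states_lift:
  assumes m: "m \<ge> 1" "X m \<subseteq> Z" and s: "(x, f) \<in> states smul (X m)"
  shows "(x, \<lambda>y. f (P m y)) \<in> states smul Z"
proof (rule statesI)
  have f: "f \<in> dual smul (X m)" using s by (rule statesD)
  have le: "norm (f (P m y)) \<le> norm y" for y
    using statesD(6)[OF s P_in_X[OF m(1)]] P_norm_le[OF m(1)] by (rule order_trans)
  then show "norm (f (P m y)) \<le> norm y" for y .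
  show "(\<lambda>y. f (P m y)) \<in> dual smul Z"
    using le by (intro dualI[where B = 1])
      (simp_all add: P_add[OF m(1)] P_scale[OF m(1)] P_in_X[OF m(1)] dualD[OF f])
qed (use statesD[OF s] m P_fixes in auto)

text \<open>The key estimate, where (CC) enters. The general \<open>Z\<close> lets it serve both for
  operators on some \<open>X n\<close> and for operators on the whole space.\<close>

lemma compression_le_radius:
  assumes m: "m \<ge> 1" "X m \<subseteq> Z" and L: "L \<in> operators smul Z" and s: "(x, f) \<in> states smul UNIV"
  shows "norm (f (P m (L (P m x)))) \<le> numerical_radius smul Z L"
\<comment> \<open>(CC) is silent when \<open>P m x = 0\<close>; the left side is then 0, and a state
  lifted to \<open>Z\<close> ensures that the radius is nonnegative.\<close>
proof (cases "P m x = 0")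
  case True
  have "0 \<in> Z" using subspace_0[OF subspace_X[OF m(1)]] m by auto
  then have "L 0 = 0" using operatorsD(3)[OF L, of 0 0] by simp
  moreover have "P m 0 = 0" using P_scale[OF m(1), of 0 0] by simp
  moreover have "f 0 = 0" using dualD(2)[OF statesD(3)[OF s], of 0 0] by simp
  ultimately have "f (P m (L (P m x))) = 0" by (simp add: True)
  moreover have "states smul Z \<noteq> {}"
    using states_X_nonempty[OF m(1)] states_lift[OF m] by fastforce
  ultimately show ?thesis using numerical_radius_nonneg[OF L] by simp
next
  case False
  define u where "u = smul (of_real (inverse (norm (P m x)))) (P m x)"
  have u: "u \<in> X m" "norm u = 1" and Pu: "smul (of_real (norm (P m x))) u = P m x"
    using scale_inverse_norm[OF False] P_in_X[OF m(1)] subspace_X[OF m(1)]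
    by (auto simp: u_def subspace_scale)
  have "norming_functional smul UNIV x f"
    using statesD[OF s] by (simp add: norming_functional_def)
  with CC m False statesD(2)[OF s] obtain b
    where b: "norming_functional smul (X m) (P m x) (\<lambda>y. b * f y)"
    unfolding characterization_condition_def by blast
  have dual: "(\<lambda>y. b * f y) \<in> dual smul (X m)" using b by (simp add: norming_functional_def)
  have fs: "f (smul c y) = c * f y" for c y using dualD(2)[OF statesD(3)[OF s]] by simp
  have "of_real (norm (P m x)) * (b * f u) = b * f (P m x)"
    by (subst Pu[symmetric]) (simp add: fs)
  also have "\<dots> = of_real (norm (P m x)) * 1" using b by (simp add: norming_functional_def)
  finally have bu: "b * f u = 1" using False by simp
  \<comment> \<open>As \<open>u\<close> is a unit vector, \<open>f u\<close> has modulus at most 1,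
    which forces \<open>norm b \<ge> 1\<close>.\<close>
  have "1 = norm b * norm (f u)" using bu by (metis norm_mult norm_one)
  also have "\<dots> \<le> norm b * 1"
    using statesD(6)[OF s, of u] u by (intro mult_left_mono) auto
  finally have b1: "norm b \<ge> 1" by simp
  have "(u, \<lambda>y. b * f y) \<in> states smul (X m)"
    using u b bu by (simp add: states_def norming_functional_def)
  then have st: "(u, \<lambda>y. b * f (P m y)) \<in> states smul Z" by (rule states_lift[OF m])
  have "f (P m (L (P m x))) = f (P m (L (smul (of_real (norm (P m x))) u)))"
    by (simp only: Pu)
  also have "\<dots> = of_real (norm (P m x)) * f (P m (L u))"
    using operatorsD(3)[OF L, of u] u m by (auto simp: P_scale fs)
  finally have "norm (f (P m (L (P m x)))) = norm (P m x) * norm (f (P m (L u)))"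
    by (simp add: norm_mult)
  \<comment> \<open>The factor \<open>norm (P m x) \<le> 1 \<le> norm b\<close> is exchanged for
    \<open>norm b\<close> to reach the state built from \<open>b\<close>.\<close>
  also have "\<dots> \<le> norm b * norm (f (P m (L u)))"
    using b1 P_norm_le[OF m(1), of x] statesD(2)[OF s] by (intro mult_right_mono) auto
  also have "\<dots> \<le> numerical_radius smul Z L"
    using numerical_radius_upper[OF L st] by (simp add: norm_mult)
  finally show ?thesis .
qed

section \<open>Equality of \<open>n1\<close> and the numerical radius\<close>

lemma n1_le:
  assumes "J \<noteq> {}" "\<And>j. j \<in> J \<Longrightarrow> j \<ge> 1 \<and> X j \<subseteq> Z" "L \<in> operators smul Z"
  shows "n1 smul P J L \<le> numerical_radius smul Z L"
  unfolding n1_eq using assms states_UNIV_nonempty compression_le_radius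
  by (intro cSUP_least) auto

lemma n1_upper:
  assumes J: "\<And>j. j \<in> J \<Longrightarrow> j \<ge> 1 \<and> X j \<subseteq> Z" and L: "L \<in> operators smul Z"
    and j: "j \<in> J" and s: "(x, f) \<in> states smul UNIV"
  shows "norm (f (P j (L (P j x)))) \<le> n1 smul P J L"
proof -
  have "bdd_above ((\<lambda>(j, x, f). norm (f (P j (L (P j x))))) ` (J \<times> states smul UNIV))"
    using compression_le_radius[OF _ _ L] J by (intro bdd_aboveI2[where M = "numerical_radius smul Z L"]) auto
  from cSUP_upper[OF _ this, of "(j, x, f)"] show ?thesis
    using j s by (simp add: n1_eq)
qed

text \<open>For the lower bound the index \<open>j = m\<close> suffices: \<open>P m\<close> changes
  neither \<open>x\<close> nor \<open>L x\<close>, and each state of \<open>X m\<close> lifts to the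
  whole space.\<close>

lemma n1_X:
  assumes m: "m \<ge> 1" and L: "L \<in> operators smul (X m)"
  shows "n1 smul P {1..m} L = numerical_radius smul (X m) L"
proof (rule antisym)
  have J: "j \<ge> 1 \<and> X j \<subseteq> X m" if "j \<in> {1..m}" for j
    using that X_mono by auto
  show "n1 smul P {1..m} L \<le> numerical_radius smul (X m) L"
    using m by (intro n1_le J L) auto
  show "numerical_radius smul (X m) L \<le> n1 smul P {1..m} L"
  proof (rule numerical_radius_le[OF states_X_nonempty[OF m]])
    fix x f assume s: "(x, f) \<in> states smul (X m)"
    have x: "x \<in> X m" using s by (rule statesD)
    \<comment> \<open>The outermost \<open>P m\<close> belongs to the lifted functional, the other
      two to \<open>n1\<close>.\<close>
    have "f (L x) = f (P m (P m (L (P m x))))"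
      using m x operatorsD(1)[OF L x] by (simp add: P_fixes)
    also have "norm \<dots> \<le> n1 smul P {1..m} L"
      using m by (intro n1_upper[OF J L] states_lift[OF m subset_UNIV s]) auto
    finally show "norm (f (L x)) \<le> n1 smul P {1..m} L" .
  qed
qed

text \<open>The lower bound is reached in the limit: for a fixed state the compressed values
  converge to \<open>f (L x)\<close>, and \<open>n1\<close> bounds them all.\<close>

lemma n1_UNIV:
  assumes L: "L \<in> operators smul UNIV"
  shows "n1 smul P {1..} L = numerical_radius smul UNIV L"
proof (rule antisym)
  have J: "j \<ge> 1 \<and> X j \<subseteq> UNIV" if "j \<in> {1..}" for j
    using that by auto
  show "n1 smul P {1..} L \<le> numerical_radius smul UNIV L"
    by (intro n1_le J L) auto
  show "numerical_radius smul UNIV L \<le> n1 smul P {1..} L"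
  proof (rule numerical_radius_le[OF states_UNIV_nonempty])
    fix x f assume s: "(x, f) \<in> states smul UNIV"
    have f_diff: "f (y - z) = f y - f z" for y z
      using dualD(1)[OF statesD(3)[OF s], of "y - z" z] by simp
    have "(\<lambda>m. norm (f (P m (L (P m x))))) \<longlonglongrightarrow> norm (f (L x))"
    proof (rule tendsto_norm, rule LIM_zero_cancel, rule Lim_null_comparison)
      show "\<forall>\<^sub>F m in sequentially.
          norm (f (P m (L (P m x))) - f (L x)) \<le> norm (P m (L (P m x)) - L x)"
        using statesD(6)[OF s] by (simp flip: f_diff)
      show "(\<lambda>m. norm (P m (L (P m x)) - L x)) \<longlonglongrightarrow> 0"
        using compression_tendsto[OF L] by (intro tendsto_norm_zero) (simp add: LIM_zero)
    qed
    moreover have "\<forall>\<^sub>F m in sequentially. norm (f (P m (L (P m x)))) \<le> n1 smul P {1..} L"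
      using eventually_ge_at_top[of 1] by eventually_elim (auto intro: n1_upper[OF J L _ s])
    ultimately show "norm (f (L x)) \<le> n1 smul P {1..} L"
      by (intro tendsto_upperbound) auto
  qed
qed

section \<open>Convergence of the numerical indices\<close>

text \<open>Each norm-one \<open>L\<close> on \<open>X m\<close> extends to \<open>L\<close> after
  \<open>P m\<close>, which has norm 1 and no larger numerical radius.\<close>

lemma numerical_index_UNIV_le_X:
  assumes m: "m \<ge> 1"
  shows "numerical_index smul UNIV \<le> numerical_index smul (X m)"
  unfolding numerical_index_def[of smul "X m"]
proof (rule cInf_greatest)
  obtain z where z: "z \<in> X m" "z \<noteq> 0" using X_nontrivial[OF m] .
  then show "{numerical_radius smul (X m) T |T. T \<in> operators smul (X m) \<and> onorm_on (X m) T = 1} \<noteq> {}"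
    by (rule numerical_index_set_nonempty)
  fix r assume "r \<in> {numerical_radius smul (X m) T |T. T \<in> operators smul (X m) \<and> onorm_on (X m) T = 1}"
  then obtain L where L: "L \<in> operators smul (X m)" "onorm_on (X m) L = 1"
    and r: "r = numerical_radius smul (X m) L" by auto
  have bL: "bounded_linear_on smul smul (X m) L" using L(1) by (simp add: operators_def)
  define T where "T x = L (P m x)" for x
  have le: "norm (T x) \<le> norm x" for x
    using onorm_on_bound[OF bL P_in_X[OF m]] P_norm_le[OF m, of x] L(2)
    unfolding T_def by (metis mult_1 order_trans)
  have T: "T \<in> operators smul UNIV"
    using le by (intro operatorsI[where B = 1])
      (simp_all add: T_def P_add[OF m] P_scale[OF m] P_in_X[OF m] operatorsD[OF L(1)])
  then have bT: "bounded_linear_on smul smul UNIV T" by (simp add: operators_def)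
  have "onorm_on UNIV T \<le> 1" using le by (intro onorm_on_le) auto
  moreover have "onorm_on (X m) L \<le> onorm_on UNIV T"
  proof (rule onorm_on_le)
    show "norm (L x) \<le> onorm_on UNIV T * norm x" if "x \<in> X m" for x
      using onorm_on_bound[OF bT, of x] P_fixes[OF m that] by (simp add: T_def)
  qed (use z onorm_on_nonneg[OF bT] in auto)
  ultimately have "onorm_on UNIV T = 1" using L(2) by simp
  then have "numerical_index smul UNIV \<le> numerical_radius smul UNIV T"
    using T z(2) by (intro numerical_index_le) auto
  also have "\<dots> \<le> r"
  proof (rule numerical_radius_le[OF states_UNIV_nonempty])
    fix x f assume s: "(x, f) \<in> states smul UNIV"
    \<comment> \<open>The range of \<open>T\<close> lies in \<open>X m\<close>, so \<open>T\<close>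
      is its own compression and the key estimate applies with \<open>Z = X m\<close>.\<close>
    have "P m (L (P m x)) = T x"
      using m operatorsD(1)[OF L(1)] by (simp add: T_def P_fixes P_in_X)
    with compression_le_radius[OF m order_refl L(1) s] show "norm (f (T x)) \<le> r"
      by (simp add: r)
  qed
  finally show "numerical_index smul UNIV \<le> r" .
qed

text \<open>The quotient is a lower bound for the norm of \<open>P m\<close> after \<open>T\<close>
  on \<open>X m\<close>, whose radius is at most that of \<open>T\<close> by lifting states. A
  quotient at one vector \<open>x\<close> is used because its limit in \<open>m\<close> needs only
  pointwise convergence.\<close>

lemma numerical_index_X_mult_le:
  assumes m: "m \<ge> 1" and T: "T \<in> operators smul UNIV"
  shows "numerical_index smul (X m) * (norm (P m (T (P m x))) / norm (P m x))
    \<le> numerical_radius smul UNIV T"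
proof -
  obtain z where z: "z \<in> X m" "z \<noteq> 0" using X_nontrivial[OF m] .
  obtain B where B: "\<And>x. norm (T x) \<le> B * norm x"
    using T by (auto simp: operators_def bounded_linear_on_def)
  define S where "S y = P m (T y)" for y
  have S: "S \<in> operators smul (X m)"
    using m P_norm_le[OF m] B by (intro operatorsI[where B = B])
      (auto simp: S_def P_in_X P_add P_scale operatorsD[OF T] intro: order_trans)
  have "numerical_index smul (X m) * (norm (S (P m x)) / norm (P m x))
      \<le> numerical_index smul (X m) * onorm_on (X m) S"
    using S P_in_X[OF m] numerical_index_nonneg[OF subspace_X[OF m] z]
    by (intro mult_left_mono onorm_on_ge[of smul smul]) (auto simp: operators_def)
  also have "\<dots> \<le> numerical_radius smul (X m) S"
    using subspace_X[OF m] z S by (rule numerical_index_mult_le)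
  also have "\<dots> \<le> numerical_radius smul UNIV T"
  proof (rule numerical_radius_le[OF states_X_nonempty[OF m]])
    fix x f assume "(x, f) \<in> states smul (X m)"
    from numerical_radius_upper[OF T states_lift[OF m subset_UNIV this]]
    show "norm (f (S x)) \<le> numerical_radius smul UNIV T" by (simp add: S_def)
  qed
  finally show ?thesis by (simp add: S_def)
qed

lemma eventually_numerical_index_X_less:
  assumes "numerical_index smul UNIV < c"
  shows "\<forall>\<^sub>F m in sequentially. numerical_index smul (X m) < c"
proof -
  obtain z where z: "z \<in> X 1" "z \<noteq> 0" using X_nontrivial[OF order_refl] .
  have c: "0 < c"
    using numerical_index_nonneg[OF subspace_UNIV UNIV_I z(2)] assms by simp
  have "\<exists>r\<in>{numerical_radius smul UNIV T |T. T \<in> operators smul UNIV \<and> onorm_on UNIV T = 1}. r < c"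
    using assms numerical_index_set_nonempty[OF UNIV_I z(2)]
    unfolding numerical_index_def by (intro cInf_lessD)
  then obtain T where T: "T \<in> operators smul UNIV" "onorm_on UNIV T = 1"
    and Tc: "numerical_radius smul UNIV T < c"
    by blast
  \<comment> \<open>As \<open>q < 1\<close> and \<open>T\<close> has norm 1, some \<open>x\<close>
    has quotient above \<open>q\<close>, and so do its compressions for large
    \<open>m\<close>.\<close>
  define q where "q = numerical_radius smul UNIV T / c"
  have q: "0 \<le> q" "q < 1"
    using c Tc numerical_radius_nonneg[OF T(1) states_UNIV_nonempty] by (auto simp: q_def)
  have "q < (SUP x. norm (T x) / norm x)"
    using q(2) T(2) by (simp add: onorm_on_def)
  then have "\<exists>r\<in>range (\<lambda>x. norm (T x) / norm x). q < r"
    by (intro less_cSupD) simp_all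
  then obtain x where x: "q < norm (T x) / norm x" by blast
  then have "x \<noteq> 0" using q(1) by auto
  then have "(\<lambda>m. norm (P m (T (P m x))) / norm (P m x)) \<longlonglongrightarrow> norm (T x) / norm x"
    by (intro tendsto_divide tendsto_norm compression_tendsto P_tendsto T) auto
  then have "\<forall>\<^sub>F m in sequentially. q < norm (P m (T (P m x))) / norm (P m x)"
    using x by (rule order_tendstoD)
  then show ?thesis
    using eventually_ge_at_top[of 1]
  proof eventually_elim
    case (elim m)
    show ?case
    \<comment> \<open>An index of at least \<open>c\<close> would make the radius of
      \<open>T\<close> exceed \<open>c * q\<close>, which is that radius itself.\<close>
    proof (rule ccontr)
      assume "\<not> numerical_index smul (X m) < c"
      then have "c * (norm (P m (T (P m x))) / norm (P m x))
          \<le> numerical_index smul (X m) * (norm (P m (T (P m x))) / norm (P m x))"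
        by (intro mult_right_mono) auto
      also have "\<dots> \<le> numerical_radius smul UNIV T"
        by (rule numerical_index_X_mult_le[OF elim(2) T(1)])
      finally have "c * (norm (P m (T (P m x))) / norm (P m x)) \<le> numerical_radius smul UNIV T" .
      moreover have "c * q < c * (norm (P m (T (P m x))) / norm (P m x))"
        using c elim(1) by (rule mult_strict_left_mono[rotated])
      ultimately show False using c by (simp add: q_def)
    qed
  qed
qed

text \<open>The lower half holds for every \<open>m \<ge> 1\<close>, the upper half for large
  \<open>m\<close>.\<close>

lemma numerical_index_tendsto:
  "(\<lambda>m. numerical_index smul (X m)) \<longlonglongrightarrow> numerical_index smul UNIV"
proof (rule order_tendstoI)
  fix c assume c: "c < numerical_index smul UNIV"
  show "\<forall>\<^sub>F m in sequentially. c < numerical_index smul (X m)"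
    using eventually_ge_at_top[of 1]
  proof eventually_elim
    case (elim m)
    from c numerical_index_UNIV_le_X[OF elim] show ?case by (rule less_le_trans)
  qed
qed (rule eventually_numerical_index_X_less)

end

theorem theorem2p6:
  fixes smul :: "'k::real_or_complex \<Rightarrow> 'a::banach \<Rightarrow> 'a"
    and X :: "nat \<Rightarrow> 'a set"
    and P :: "nat \<Rightarrow> 'a \<Rightarrow> 'a"
  assumes "banach_space_over smul"
    and "\<And>m. m \<ge> 1 \<Longrightarrow> module.subspace smul (X m)"
    and "\<And>m. m \<ge> 1 \<Longrightarrow> closed (X m)"
    and "\<And>m. m \<ge> 1 \<Longrightarrow> X m \<subseteq> X (Suc m)"
    and "closure (\<Union>m\<in>{1..}. X m) = UNIV"
    and "\<And>m. m \<ge> 1 \<Longrightarrow> P m \<in> operators smul UNIV"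
    and "\<And>m. m \<ge> 1 \<Longrightarrow> range (P m) = X m"
    and "\<And>m x. m \<ge> 1 \<Longrightarrow> P m (P m x) = P m x"
    and "\<And>m. m \<ge> 1 \<Longrightarrow> onorm (P m) = 1"
    and "\<And>m j x. m \<ge> 1 \<Longrightarrow> j \<ge> m \<Longrightarrow> P m (P j x) = P m x"
    and "characterization_condition smul X P"
  shows "(\<forall>m\<ge>1. \<forall>L\<in>operators smul (X m). n1 smul P {1..m} L = numerical_radius smul (X m) L) \<and>
         (\<forall>L\<in>operators smul UNIV. n1 smul P {1..} L = numerical_radius smul UNIV L) \<and>
         (\<lambda>m. numerical_index smul (X m)) \<longlonglongrightarrow> numerical_index smul UNIV"
proof -
  interpret banach_space_over smul by fact
  interpret projection_scheme smul X P
    by unfold_locales (fact assms)+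
  show ?thesis using n1_X n1_UNIV numerical_index_tendsto by blast
qed

end
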